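(* Let $E$ and $F$ be Archimedean Riesz spaces, and let $F^{\delta}$ be an order completion of $F$ with corresponding bipositive linear map $i:F\to F^{\delta}$. If $E$ is atomic and the uniform closure in $E$ of the linear span of the atoms of $E$ is equal to $E$ or has codimension $1$ in $E$, then $\mathcal{L}^r(E,F)$ is pervasive in $\mathcal{L}^r(E,F^{\delta})$; that is, for every $T\in\mathcal{L}^r(E,F^{\delta})$ with $T>0$ there is $S\in\mathcal{L}^r(E,i(F))$ with $0<S\le T$.
   Context: Riesz space = vector lattice. $\mathcal{L}^r(E,F)$ is the space of regular operators (differences of positive linear operators) $E\to F$, ordered by $S\le T$ iff $S(x)\le T(x)$ for all $x\in E_+$. Order completion: an order complete Riesz space $F^{\delta}$ with a linear bipositive map $i:F\to F^{\delta}$ ($x\ge0$ iff $i(x)\ge0$) such that $i(F)$ is majorizing (every element of $F^\delta$ lies below some element of $i(F)$) and pervasive in $F^{\delta}$ (for every $0<x\in F^\delta$ there is $y\in i(F)$ with $0<y\le x$). $\mathcal{L}^r(E,i(F))$ is regarded as a subspace of $\mathcal{L}^r(E,F^{\delta})$. An element $e\in X_+$ of an Archimedean Riesz space $X$ is an atom if $0\le x\le e$ implies that $x$ is a scalar multiple of $e$. A family $\{e_i\mid i\in I\}$ is a complete disjoint system if $e_i>0$ for each $i$, $e_i\wedge e_j=0$ for $i\ne j$, and $x\wedge e_i=0$ for all $i\in I$ implies $x=0$. $X$ is atomic if it has a complete disjoint system consisting of atoms. A net $(x_\alpha)$ in $X$ converges uniformly to $x$ ($x_\alpha\xrightarrow{u}x$)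 if there is $v\in X_+$ such that for all $\epsilon>0$ there is $\alpha_0$ with $|x_\alpha-x|\le\epsilon v$ for all $\alpha\ge\alpha_0$. The uniform closure of $K\subseteq X$ is $\overline{K}^{u}=\{x\in X\mid x_n\xrightarrow{u}x\text{ for some sequence }(x_n)\subseteq K\}$. *)

theory Defs
  imports Complex_Main "HOL-Library.Lattice_Algebras"
begin

class riesz_space = ordered_real_vector + lattice_ab_group_add_abs

class archimedean_riesz_space = riesz_space +
  assumes archimedean: "(\<And>n::nat. real n *\<^sub>R x \<le> y) \<Longrightarrow> x \<le> 0"

text \<open>With this definition \<open>0\<close> counts as an atom; members of a complete disjoint system are
  nevertheless nonzero, and the span of the atoms is not affected.\<close>

definition atom :: "'a::riesz_space \<Rightarrow> bool" where
  "atom e \<longleftrightarrow> 0 \<le> e \<and> (\<forall>x. 0 \<le> x \<and> x \<le> e \<longrightarrow> (\<exists>c. x = c *\<^sub>R e))"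

definition complete_disjoint_system :: "'i set \<Rightarrow> ('i \<Rightarrow> 'a::riesz_space) \<Rightarrow> bool" where
  "complete_disjoint_system I e \<longleftrightarrow>
     (\<forall>i\<in>I. 0 < e i) \<and>
     (\<forall>i\<in>I. \<forall>j\<in>I. i \<noteq> j \<longrightarrow> inf (e i) (e j) = 0) \<and>
     (\<forall>x. (\<forall>i\<in>I. inf x (e i) = 0) \<longrightarrow> x = 0)"

text \<open>A complete disjoint system is injective, so every such family can be reindexed by a set of
  elements of the space itself: fixing the type of indices below loses no generality.\<close>

definition atomic_space :: "'a::riesz_space itself \<Rightarrow> bool" where
  "atomic_space _ \<longleftrightarrow>
     (\<exists>(I :: 'a set) (e :: 'a \<Rightarrow> 'a). complete_disjoint_system I e \<and> (\<forall>i\<in>I. atom (e i)))"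

text \<open>Relatively uniform convergence, with filters in place of nets; it is used below for
  \<^term>\<open>sequentially\<close>.\<close>

definition uniformly_converges :: "('b \<Rightarrow> 'a::riesz_space) \<Rightarrow> 'a \<Rightarrow> 'b filter \<Rightarrow> bool" where
  "uniformly_converges f x \<F> \<longleftrightarrow>
     (\<exists>v\<ge>0. \<forall>\<epsilon>>0. eventually (\<lambda>a. \<bar>f a - x\<bar> \<le> \<epsilon> *\<^sub>R v) \<F>)"

definition uniform_closure :: "'a::riesz_space set \<Rightarrow> 'a set" where
  "uniform_closure K =
     {x. \<exists>f :: nat \<Rightarrow> 'a. (\<forall>n. f n \<in> K) \<and> uniformly_converges f x sequentially}"

text \<open>Codimension as the dimension of an algebraic complement. The library's \<^term>\<open>dim\<close> is \<open>0\<close> on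
  infinite-dimensional subspaces, so \<open>dim L = 1\<close> does express one-dimensionality.\<close>

definition codimension_one :: "'a::real_vector set \<Rightarrow> bool" where
  "codimension_one K \<longleftrightarrow>
     subspace K \<and>
     (\<exists>L. subspace L \<and> dim L = 1 \<and> K \<inter> L = {0} \<and> (\<forall>x. \<exists>k\<in>K. \<exists>l\<in>L. x = k + l))"

text \<open>The order and its zero element are parameters because the notion is used both for elements of
  a Riesz space and for operators, whose order is not the pointwise order of the function type.\<close>

definition pervasive_wrt :: "('a \<Rightarrow> 'a \<Rightarrow> bool) \<Rightarrow> 'a \<Rightarrow> 'a set \<Rightarrow> 'a set \<Rightarrow> bool" where
  "pervasive_wrt le z Y X \<longleftrightarrow>
     (\<forall>x\<in>X. le z x \<and> x \<noteq> z \<longrightarrow> (\<exists>y\<in>Y. le z y \<and> y \<noteq> z \<and> le y x))"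

definition majorizing :: "'a::order set \<Rightarrow> bool" where
  "majorizing Y \<longleftrightarrow> (\<forall>x. \<exists>y\<in>Y. x \<le> y)"

definition bipositive :: "('a::riesz_space \<Rightarrow> 'b::riesz_space) \<Rightarrow> bool" where
  "bipositive i \<longleftrightarrow> (\<forall>x. 0 \<le> x \<longleftrightarrow> 0 \<le> i x)"

text \<open>Order (Dedekind) completeness of the target is its sort
  \<^class>\<open>conditionally_complete_lattice\<close>.\<close>

definition order_completion ::
  "('a::riesz_space \<Rightarrow> 'b::{riesz_space, conditionally_complete_lattice}) \<Rightarrow> bool" where
  "order_completion i \<longleftrightarrow>
     linear i \<and> bipositive i \<and> majorizing (range i) \<and> pervasive_wrt (\<le>) 0 (range i) UNIV"

definition positive_operator :: "('a::riesz_space \<Rightarrow> 'b::riesz_space) \<Rightarrow> bool" where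
  "positive_operator T \<longleftrightarrow> linear T \<and> (\<forall>x\<ge>0. 0 \<le> T x)"

text \<open>The regular operators into a subspace \<open>G\<close> of \<open>'b\<close> with the induced order, as maps into \<open>'b\<close>:
  both positive parts have to take their values in \<open>G\<close>.\<close>

definition regular_operators :: "'b set \<Rightarrow> ('a::riesz_space \<Rightarrow> 'b::riesz_space) set" where
  "regular_operators G =
     {T. \<exists>P Q. positive_operator P \<and> range P \<subseteq> G \<and> positive_operator Q \<and> range Q \<subseteq> G \<and>
           T = (\<lambda>x. P x - Q x)}"

definition operator_le :: "('a::riesz_space \<Rightarrow> 'b::riesz_space) \<Rightarrow> ('a \<Rightarrow> 'b) \<Rightarrow> bool" where
  "operator_le S T \<longleftrightarrow> (\<forall>x\<ge>0. S x \<le> T x)"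

end

theory Submission
  imports Defs
begin

text \<open>The assumption on the atoms of \<open>E\<close> ensures that each operator \<open>T > 0\<close> from \<open>E\<close> into \<open>F\<^sup>\<delta>\<close>
  dominates a rank-one operator \<open>x \<mapsto> \<phi>(x) w\<close> with \<open>\<phi>\<close> a nonzero positive functional and \<open>w > 0\<close>.
  Since \<open>i(F)\<close> is pervasive in \<open>F\<^sup>\<delta>\<close>, there is
  \<open>0 < i(f) \<le> w\<close>, and \<open>x \<mapsto> \<phi>(x) i(f)\<close> is the operator with values in \<open>i(F)\<close> that is sought
  (\<open>rank_one_minorant\<close>). The functional \<open>\<phi>\<close> is found in one of two ways.

  If \<open>T a \<noteq> 0\<close> for some atom \<open>a\<close>, let \<open>\<phi>\<close> be the coordinate functional of \<open>a\<close>: in an Archimedean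
  space the line through an atom is a projection band, so every \<open>x\<close> is \<open>\<phi>(x) a + r\<close> with
  \<open>r\<close> disjoint from \<open>a\<close>, and \<open>r \<ge> 0\<close> if \<open>x \<ge> 0\<close>. Hence \<open>T x \<ge> \<phi>(x) T a\<close> for \<open>x \<ge> 0\<close>
  (\<open>atom_coordinate\<close>).

  If \<open>T\<close> vanishes at all atoms, then it vanishes on their span, and on the uniform closure of the
  span as well, because positive operators preserve uniform convergence and \<open>F\<^sup>\<delta>\<close> is Archimedean
  (\<open>positive_operator_zero_on_uniform_closure\<close>). As \<open>T \<noteq> 0\<close>, the closure has codimension one;
  so \<open>T\<close> itself has rank one, and the functional in \<open>T x = \<phi>(x) w\<close> is positive as soon as \<open>w > 0\<close>
  (\<open>positive_rank_one_factorization\<close>).\<close>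

section \<open>Disjointness in Riesz spaces\<close>

definition disjoint_complement :: "'a::riesz_space \<Rightarrow> 'a set" where
  "disjoint_complement a = {r. inf \<bar>r\<bar> a = 0}"

lemma abs_scaleR_le:
  fixes x :: "'a::riesz_space"
  shows "\<bar>c *\<^sub>R x\<bar> \<le> \<bar>c\<bar> *\<^sub>R \<bar>x\<bar>"
proof (cases "0 \<le> c")
  case True
  have "- (c *\<^sub>R x) = c *\<^sub>R (- x)" by simp
  also have "\<dots> \<le> c *\<^sub>R \<bar>x\<bar>"
    by (rule scaleR_left_mono[OF abs_ge_minus_self True])
  finally show ?thesis
    using abs_leI[OF scaleR_left_mono[OF abs_ge_self True]] True by simp
next
  case False
  then have c: "0 \<le> - c" by simp
  have "c *\<^sub>R x = (- c) *\<^sub>R (- x)" by simp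
  also have "\<dots> \<le> (- c) *\<^sub>R \<bar>x\<bar>"
    by (rule scaleR_left_mono[OF abs_ge_minus_self c])
  finally have 1: "c *\<^sub>R x \<le> (- c) *\<^sub>R \<bar>x\<bar>" .
  have "- (c *\<^sub>R x) = (- c) *\<^sub>R x" by simp
  also have "\<dots> \<le> (- c) *\<^sub>R \<bar>x\<bar>"
    by (rule scaleR_left_mono[OF abs_ge_self c])
  finally show ?thesis
    using abs_leI[OF 1] False by simp
qed

lemma inf_add_eq_zero:
  fixes a x y :: "'a::riesz_space"
  assumes "0 \<le> x" "0 \<le> y" "inf x a = 0" "inf y a = 0"
  shows "inf (x + y) a = 0"
proof (rule antisym)
  have a: "0 \<le> a"
    using assms(3) inf_le2[of x a] by simp
  define z where "z = inf (x + y) a"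
  have "z - y \<le> x"
    by (simp add: z_def diff_le_eq)
  moreover have "z - y \<le> a"
    using assms(2) inf_le2[of "x + y" a] by (simp add: z_def diff_le_eq add_increasing2)
  ultimately have "z - y \<le> 0"
    using assms(3) by (metis le_infI)
  moreover have "z \<le> a"
    by (simp add: z_def)
  ultimately have "z \<le> inf y a"
    by simp
  then show "inf (x + y) a \<le> 0"
    using assms(4) by (simp add: z_def)
  show "0 \<le> inf (x + y) a"
    using assms(1,2) a by simp
qed

lemma inf_of_nat_scaleR_eq_zero:
  fixes a x :: "'a::riesz_space"
  assumes "0 \<le> x" "inf x a = 0"
  shows "inf (real n *\<^sub>R x) a = 0"
proof (induction n)
  case 0
  have "0 \<le> a"
    using assms(2) inf_le2[of x a] by simp
  then show ?case
    by (simp add: inf_absorb1)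
next
  case (Suc n)
  have "inf (x + real n *\<^sub>R x) a = 0"
    by (rule inf_add_eq_zero) (use assms Suc in \<open>simp_all add: scaleR_nonneg_nonneg\<close>)
  then show ?case
    by (simp add: scaleR_left_distrib)
qed

lemma subspace_disjoint_complement:
  fixes a :: "'a::riesz_space"
  assumes a: "0 \<le> a"
  shows "subspace (disjoint_complement a)"
proof -
  have dominated: "inf \<bar>x\<bar> a = 0" if "\<bar>x\<bar> \<le> y" "inf y a = 0" for x y :: 'a
    using that a by (metis abs_ge_zero inf.boundedI inf_mono order.refl order.antisym)
  show ?thesis
    unfolding subspace_def disjoint_complement_def mem_Collect_eq
  proof (intro conjI ballI allI)
    show "inf \<bar>0\<bar> a = 0"
      using a by (simp add: inf_absorb1)
    fix x y assume "x \<in> {r. inf \<bar>r\<bar> a = 0}" "y \<in> {r. inf \<bar>r\<bar> a = 0}"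
    then have "inf (\<bar>x\<bar> + \<bar>y\<bar>) a = 0"
      by (intro inf_add_eq_zero) simp_all
    then show "inf \<bar>x + y\<bar> a = 0"
      by (rule dominated[OF abs_triangle_ineq])
  next
    fix c x assume "x \<in> {r. inf \<bar>r\<bar> a = 0}"
    then have x: "inf \<bar>x\<bar> a = 0" by simp
    obtain n where "\<bar>c\<bar> \<le> real n"
      using real_arch_simple by blast
    then have "\<bar>c *\<^sub>R x\<bar> \<le> real n *\<^sub>R \<bar>x\<bar>"
      by (meson abs_ge_zero abs_scaleR_le order_trans scaleR_right_mono)
    then show "inf \<bar>c *\<^sub>R x\<bar> a = 0"
      by (rule dominated) (simp add: inf_of_nat_scaleR_eq_zero x)
  qed
qed

section \<open>The coordinate functional of an atom\<close>

text \<open>The coefficient is the largest \<open>c\<close> with \<open>c a \<le> x\<close>, which exists by the Archimedean property.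
  The infimum of \<open>a\<close> with the remainder is a multiple of the atom \<open>a\<close>, and a nonzero multiple
  would contradict the maximality of \<open>c\<close>.\<close>

lemma atom_decomposition_nonneg:
  fixes a x :: "'a::archimedean_riesz_space"
  assumes "atom a" "a \<noteq> 0" "0 \<le> x"
  shows "\<exists>c\<ge>0. c *\<^sub>R a \<le> x \<and> x - c *\<^sub>R a \<in> disjoint_complement a"
proof -
  have a: "0 \<le> a"
    using assms(1) by (simp add: atom_def)
  define S where "S = {c. c *\<^sub>R a \<le> x}"
  have zero: "0 \<in> S"
    using assms(3) by (simp add: S_def)
  have bdd: "bdd_above S"
  proof (rule ccontr)
    assume "\<not> bdd_above S"
    then have "\<exists>c\<in>S. real n \<le> c" for n
      unfolding bdd_above_def by (meson linorder_le_cases)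
    then have "real n *\<^sub>R a \<le> x" for n
      unfolding S_def using a by (metis mem_Collect_eq order_trans scaleR_right_mono)
    then have "a \<le> 0"
      by (rule archimedean)
    with a assms(2) show False
      by simp
  qed
  define s where "s = Sup S"
  have s0: "0 \<le> s"
    unfolding s_def by (rule cSup_upper[OF zero bdd])
  have "real n *\<^sub>R (s *\<^sub>R a - x) \<le> a" for n
  proof (cases "n = 0")
    case True
    with a show ?thesis by simp
  next
    case False
    then have "s - 1 / real n < Sup S"
      by (simp add: s_def)
    then obtain c where c: "c \<in> S" "s - 1 / real n < c"
      using less_cSup_iff[of S] zero bdd by auto
    then have "(s - 1 / real n) *\<^sub>R a \<le> x"
      unfolding S_def using a by (metis mem_Collect_eq order_trans scaleR_right_mono less_imp_le)
    then have "real n *\<^sub>R ((s - 1 / real n) *\<^sub>R a) \<le> real n *\<^sub>R x"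
      by (rule scaleR_left_mono) simp
    moreover have "real n *\<^sub>R ((s - 1 / real n) *\<^sub>R a) = real n *\<^sub>R s *\<^sub>R a - a"
      using False by (simp add: algebra_simps)
    ultimately show ?thesis
      by (simp add: algebra_simps)
  qed
  then have "s *\<^sub>R a - x \<le> 0"
    by (rule archimedean)
  then have le: "s *\<^sub>R a \<le> x"
    by simp
  define r where "r = x - s *\<^sub>R a"
  have r: "0 \<le> r"
    using le by (simp add: r_def)
  have nonneg: "0 \<le> inf r a"
    using r a by simp
  then obtain c where c: "inf r a = c *\<^sub>R a"
    using assms(1) unfolding atom_def by (meson inf_le2)
  have "(s + c) *\<^sub>R a \<le> x"
    using inf_le1[of r a] unfolding c by (simp add: r_def algebra_simps)
  then have "s + c \<le> s"
    using cSup_upper[of "s + c" S] bdd by (simp add: S_def s_def)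
  then have "inf r a \<le> 0"
    using a by (simp add: c scaleR_nonpos_nonneg)
  with nonneg have "inf r a = 0"
    by (rule antisym[rotated])
  then have "r \<in> disjoint_complement a"
    using r by (simp add: disjoint_complement_def)
  with s0 le show ?thesis
    unfolding r_def by blast
qed

lemma atom_decomposition_unique:
  fixes a x :: "'a::riesz_space"
  assumes a: "0 \<le> a" "a \<noteq> 0"
    and "x - c *\<^sub>R a \<in> disjoint_complement a" "x - d *\<^sub>R a \<in> disjoint_complement a"
  shows "c = d"
proof (rule ccontr)
  assume ne: "c \<noteq> d"
  note D = subspace_disjoint_complement[OF a(1)]
  have "(x - d *\<^sub>R a) - (x - c *\<^sub>R a) \<in> disjoint_complement a"
    using subspace_diff[OF D] assms by blast
  then have "(c - d) *\<^sub>R a \<in> disjoint_complement a"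
    by (simp add: algebra_simps)
  then have "(1 / (c - d)) *\<^sub>R (c - d) *\<^sub>R a \<in> disjoint_complement a"
    by (rule subspace_scale[OF D])
  then have "a \<in> disjoint_complement a"
    using ne by simp
  then show False
    using a by (simp add: disjoint_complement_def)
qed

text \<open>The band projection onto the line through the atom, read as a functional. Its linearity comes
  from the uniqueness of the decomposition, as the disjoint complement is a subspace.\<close>

lemma atom_coordinate:
  fixes a :: "'a::archimedean_riesz_space"
  assumes atom: "atom a" and ne: "a \<noteq> 0"
  obtains \<phi> :: "'a \<Rightarrow> real"
  where "linear \<phi>" "\<And>x. 0 \<le> x \<Longrightarrow> 0 \<le> \<phi> x" "\<And>x. 0 \<le> x \<Longrightarrow> \<phi> x *\<^sub>R a \<le> x" "\<phi> a = 1"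
proof -
  have a: "0 \<le> a"
    using atom by (simp add: atom_def)
  note D = subspace_disjoint_complement[OF a]
  have ex: "\<exists>c. x - c *\<^sub>R a \<in> disjoint_complement a" for x
  proof -
    obtain p where p: "0 \<le> p" "x \<le> p"
      using sup_ge1 sup_ge2 by blast
    obtain c where c: "p - c *\<^sub>R a \<in> disjoint_complement a"
      using atom_decomposition_nonneg[OF atom ne p(1)] by auto
    obtain d where d: "p - x - d *\<^sub>R a \<in> disjoint_complement a"
      using atom_decomposition_nonneg[OF atom ne, of "p - x"] p(2) by auto
    have "(p - c *\<^sub>R a) - (p - x - d *\<^sub>R a) \<in> disjoint_complement a"
      by (rule subspace_diff[OF D c d])
    then have "x - (c - d) *\<^sub>R a \<in> disjoint_complement a"
      by (simp add: algebra_simps)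
    then show ?thesis ..
  qed
  then obtain \<phi> where \<phi>: "x - \<phi> x *\<^sub>R a \<in> disjoint_complement a" for x
    by metis
  have eq: "\<phi> x = c" if "x - c *\<^sub>R a \<in> disjoint_complement a" for x c
    using atom_decomposition_unique[OF a ne \<phi> that] .
  show thesis
  proof
    show "linear \<phi>"
    proof (rule linearI)
      fix x y
      have "(x - \<phi> x *\<^sub>R a) + (y - \<phi> y *\<^sub>R a) \<in> disjoint_complement a"
        by (rule subspace_add[OF D \<phi> \<phi>])
      then show "\<phi> (x + y) = \<phi> x + \<phi> y"
        by (intro eq) (simp add: algebra_simps)
    next
      fix c x
      have "c *\<^sub>R (x - \<phi> x *\<^sub>R a) \<in> disjoint_complement a"
        by (rule subspace_scale[OF D \<phi>])
      then show "\<phi> (c *\<^sub>R x) = c *\<^sub>R \<phi> x"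
        by (intro eq) (simp add: algebra_simps)
    qed
    show "0 \<le> \<phi> x" "\<phi> x *\<^sub>R a \<le> x" if "0 \<le> x" for x
      using atom_decomposition_nonneg[OF atom ne that] eq by auto
    show "\<phi> a = 1"
      by (rule eq) (simp add: subspace_0[OF D])
  qed
qed

section \<open>Positive operators that vanish on the atoms\<close>

text \<open>If \<open>s\<close> is the supremum of the multiples \<open>n x\<close>, then \<open>s - x\<close> is an upper bound of
  them as well, because \<open>n x + x = (n + 1) x \<le> s\<close>.\<close>

lemma conditionally_complete_imp_archimedean:
  fixes x y :: "'a::{riesz_space, conditionally_complete_lattice}"
  assumes "\<And>n::nat. real n *\<^sub>R x \<le> y"
  shows "x \<le> 0"
proof -
  define A where "A = range (\<lambda>n::nat. real n *\<^sub>R x)"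
  have bdd: "bdd_above A"
    unfolding A_def bdd_above_def using assms by auto
  have "Sup A \<le> Sup A - x"
  proof (rule cSup_least)
    show "A \<noteq> {}"
      by (simp add: A_def)
    fix z assume "z \<in> A"
    then obtain n where n: "z = real n *\<^sub>R x"
      by (auto simp: A_def)
    have "real (Suc n) *\<^sub>R x \<in> A"
      unfolding A_def by (rule rangeI)
    then have "real (Suc n) *\<^sub>R x \<le> Sup A"
      using bdd by (rule cSup_upper)
    then show "z \<le> Sup A - x"
      unfolding n by (simp add: algebra_simps)
  qed
  then show ?thesis
    by (simp add: algebra_simps)
qed

lemma positive_operator_mono:
  assumes "positive_operator T" "x \<le> y"
  shows "T x \<le> T y"
proof -
  have "0 \<le> T (y - x)"
    using assms by (simp add: positive_operator_def)
  then show ?thesis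
    using assms(1) by (simp add: positive_operator_def linear_diff)
qed

lemma positive_operator_abs_le:
  assumes "positive_operator T"
  shows "\<bar>T x\<bar> \<le> T \<bar>x\<bar>"
proof (rule abs_leI)
  show "T x \<le> T \<bar>x\<bar>"
    by (rule positive_operator_mono[OF assms abs_ge_self])
  have "T (- x) \<le> T \<bar>x\<bar>"
    by (rule positive_operator_mono[OF assms abs_ge_minus_self])
  then show "- T x \<le> T \<bar>x\<bar>"
    using assms by (simp add: positive_operator_def linear_neg)
qed

lemma positive_operator_zero_on_uniform_closure:
  fixes T :: "'a::riesz_space \<Rightarrow> 'b::{riesz_space, conditionally_complete_lattice}"
  assumes T: "positive_operator T"
    and zero: "\<And>x. x \<in> K \<Longrightarrow> T x = 0"
    and x: "x \<in> uniform_closure K"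
  shows "T x = 0"
proof -
  have lin: "linear T"
    using T by (simp add: positive_operator_def)
  obtain f v where f: "\<And>n::nat. f n \<in> K" and v: "0 \<le> v"
    and conv: "\<And>\<epsilon>. \<epsilon> > 0 \<Longrightarrow> eventually (\<lambda>n. \<bar>f n - x\<bar> \<le> \<epsilon> *\<^sub>R v) sequentially"
    using x unfolding uniform_closure_def uniformly_converges_def by blast
  have bound: "\<bar>T x\<bar> \<le> \<epsilon> *\<^sub>R T v" if \<epsilon>: "\<epsilon> > 0" for \<epsilon>
  proof -
    obtain n where "\<bar>f n - x\<bar> \<le> \<epsilon> *\<^sub>R v"
      using eventually_happens[OF conv[OF \<epsilon>]] by auto
    then have "T \<bar>f n - x\<bar> \<le> T (\<epsilon> *\<^sub>R v)"
      by (rule positive_operator_mono[OF T])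
    with positive_operator_abs_le[OF T] have "\<bar>T (f n - x)\<bar> \<le> T (\<epsilon> *\<^sub>R v)"
      by (rule order_trans)
    then show ?thesis
      using zero[OF f] by (simp add: linear_diff[OF lin] linear_scale[OF lin])
  qed
  have "real n *\<^sub>R \<bar>T x\<bar> \<le> T v" for n
  proof (cases "n = 0")
    case True
    with T v show ?thesis
      by (simp add: positive_operator_def)
  next
    case False
    then have "real n *\<^sub>R \<bar>T x\<bar> \<le> real n *\<^sub>R (1 / real n) *\<^sub>R T v"
      by (intro scaleR_left_mono bound) simp_all
    with False show ?thesis
      by simp
  qed
  then have "\<bar>T x\<bar> \<le> 0"
    by (rule conditionally_complete_imp_archimedean)
  then show ?thesis
    by simp
qed

lemma codimension_one_rank_one:
  fixes T :: "'a::real_vector \<Rightarrow> 'b::real_vector"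
  assumes codim: "codimension_one K" and lin: "linear T"
    and zero: "\<And>x. x \<in> K \<Longrightarrow> T x = 0" and w: "T x\<^sub>0 \<noteq> 0"
  shows "\<exists>c. T x = c *\<^sub>R T x\<^sub>0"
proof -
  obtain L where L: "subspace L" "dim L = 1" and sum: "\<And>x. \<exists>k\<in>K. \<exists>l\<in>L. x = k + l"
    using codim unfolding codimension_one_def by blast
  obtain B where B: "B \<subseteq> L" "L \<subseteq> span B" "card B = dim L"
    using basis_exists[of L] by metis
  then obtain b where "B = {b}"
    using L(2) by (metis card_1_singletonE)
  with B have multiple: "\<exists>c. l = c *\<^sub>R b" if "l \<in> L" for l
    using that by (auto simp: span_singleton)
  have T: "\<exists>c. T x = c *\<^sub>R T b" for x
  proof -
    obtain k l where "k \<in> K" "l \<in> L" "x = k + l"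
      using sum by blast
    with multiple zero show ?thesis
      by (metis add_0 linear_add[OF lin] linear_scale[OF lin])
  qed
  obtain d where d: "T x\<^sub>0 = d *\<^sub>R T b"
    using T by blast
  obtain c where "T x = c *\<^sub>R T b"
    using T by blast
  moreover have "d \<noteq> 0"
    using d w by auto
  ultimately have "T x = (c / d) *\<^sub>R T x\<^sub>0"
    by (simp add: d)
  then show ?thesis ..
qed

lemma positive_rank_one_factorization:
  fixes T :: "'a::riesz_space \<Rightarrow> 'b::riesz_space"
  assumes T: "positive_operator T" and w: "0 < w" and rank: "\<And>x. \<exists>c. T x = c *\<^sub>R w"
  obtains \<phi> :: "'a \<Rightarrow> real"
  where "linear \<phi>" "\<And>x. 0 \<le> x \<Longrightarrow> 0 \<le> \<phi> x" "\<And>x. T x = \<phi> x *\<^sub>R w"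
proof -
  obtain \<phi> where \<phi>: "T x = \<phi> x *\<^sub>R w" for x
    using rank by metis
  have lin: "linear T"
    using T by (simp add: positive_operator_def)
  have cancel: "c = d" if "c *\<^sub>R w = d *\<^sub>R w" for c d
    using that w by (auto simp: less_le)
  show thesis
  proof
    show "linear \<phi>"
    proof (rule linearI)
      fix x y
      show "\<phi> (x + y) = \<phi> x + \<phi> y"
        by (rule cancel) (metis \<phi> linear_add[OF lin] scaleR_left_distrib)
    next
      fix c x
      show "\<phi> (c *\<^sub>R x) = c *\<^sub>R \<phi> x"
        by (rule cancel) (metis \<phi> linear_scale[OF lin] scaleR_scaleR real_scaleR_def)
    qed
    show "0 \<le> \<phi> x" if "0 \<le> x" for x
    proof (rule ccontr)
      assume "\<not> 0 \<le> \<phi> x"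
      then have neg: "\<phi> x < 0" by simp
      have "0 \<le> \<phi> x *\<^sub>R w"
        using T that by (simp add: positive_operator_def flip: \<phi>)
      moreover have "\<phi> x *\<^sub>R w \<le> 0"
        using neg w by (simp add: scaleR_nonpos_nonneg less_imp_le)
      ultimately have "\<phi> x *\<^sub>R w = 0"
        by simp
      with neg w show False
        by simp
    qed
    show "T x = \<phi> x *\<^sub>R w" for x
      by (rule \<phi>)
  qed
qed

section \<open>Pervasiveness\<close>

lemma rank_one_minorant:
  fixes i :: "'f::riesz_space \<Rightarrow> 'g::{riesz_space, conditionally_complete_lattice}"
    and T :: "'e::riesz_space \<Rightarrow> 'g"
  assumes i: "order_completion i"
    and \<phi>: "linear \<phi>" "\<And>x. 0 \<le> x \<Longrightarrow> 0 \<le> \<phi> x" "\<phi> x\<^sub>0 \<noteq> 0"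
    and w: "0 < w"
    and le: "\<And>x. 0 \<le> x \<Longrightarrow> \<phi> x *\<^sub>R w \<le> T x"
  shows "\<exists>S\<in>regular_operators (range i).
           operator_le (\<lambda>_. 0) S \<and> S \<noteq> (\<lambda>_. 0) \<and> operator_le S T"
proof -
  have i_lin: "linear i"
    using i by (simp add: order_completion_def)
  have "\<exists>y\<in>range i. 0 \<le> y \<and> y \<noteq> 0 \<and> y \<le> w"
    using i w unfolding order_completion_def pervasive_wrt_def by (simp add: less_le)
  then obtain f where f: "0 \<le> i f" "i f \<noteq> 0" "i f \<le> w"
    by blast
  define S where "S = (\<lambda>x. \<phi> x *\<^sub>R i f)"
  have nonneg: "0 \<le> S x" if "0 \<le> x" for x
    unfolding S_def using \<phi>(2)[OF that] f(1) by (rule scaleR_nonneg_nonneg)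
  have "linear S"
    unfolding S_def using \<phi>(1)
    by (intro linearI) (simp_all add: linear_add linear_scale scaleR_left_distrib)
  then have "positive_operator S"
    using nonneg by (simp add: positive_operator_def)
  moreover have "range S \<subseteq> range i"
    unfolding S_def by (auto simp: linear_scale[OF i_lin, symmetric])
  moreover have "positive_operator (\<lambda>_::'e. 0::'g)"
    by (simp add: positive_operator_def linear_zero)
  moreover have "range (\<lambda>_::'e. 0::'g) \<subseteq> range i"
    using linear_0[OF i_lin] by (metis image_subsetI rangeI)
  moreover have "S = (\<lambda>x. S x - 0)"
    by simp
  ultimately have "S \<in> regular_operators (range i)"
    unfolding regular_operators_def by blast
  moreover have "operator_le (\<lambda>_. 0) S"
    using nonneg by (simp add: operator_le_def)
  moreover have "S x\<^sub>0 \<noteq> 0"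
    using \<phi>(3) f(2) by (simp add: S_def)
  then have "S \<noteq> (\<lambda>_. 0)"
    by auto
  moreover have "S x \<le> T x" if "0 \<le> x" for x
    unfolding S_def using scaleR_left_mono[OF f(3) \<phi>(2)[OF that]] le[OF that]
    by (rule order_trans)
  then have "operator_le S T"
    by (simp add: operator_le_def)
  ultimately show ?thesis
    by blast
qed

theorem proposition3p6:
  fixes i :: "'f::archimedean_riesz_space \<Rightarrow> 'g::{riesz_space, conditionally_complete_lattice}"
  assumes "order_completion i"
    and "atomic_space TYPE('e::archimedean_riesz_space)"
    and "uniform_closure (span {e::'e. atom e}) = UNIV \<or>
         codimension_one (uniform_closure (span {e::'e. atom e}))"
  shows "pervasive_wrt operator_le (\<lambda>_. 0)
           (regular_operators (range i) :: ('e \<Rightarrow> 'g) set) (regular_operators UNIV)"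
  unfolding pervasive_wrt_def
proof (intro ballI impI, elim conjE)
  fix T :: "'e \<Rightarrow> 'g"
  assume "T \<in> regular_operators UNIV" and T_ge: "operator_le (\<lambda>_. 0) T" and T_ne: "T \<noteq> (\<lambda>_. 0)"
  then have lin: "linear T"
    unfolding regular_operators_def positive_operator_def by (auto intro: linear_compose_sub)
  with T_ge have T: "positive_operator T"
    by (simp add: positive_operator_def operator_le_def)
  show "\<exists>S\<in>regular_operators (range i).
          operator_le (\<lambda>_. 0) S \<and> S \<noteq> (\<lambda>_. 0) \<and> operator_le S T"
  proof (cases "\<exists>a. atom a \<and> T a \<noteq> 0")
    case True
    then obtain a where a: "atom a" "T a \<noteq> 0"
      by blast
    then have "a \<noteq> 0"
      using linear_0[OF lin] by auto
    then obtain \<phi> where \<phi>: "linear \<phi>" "\<And>x. 0 \<le> x \<Longrightarrow> 0 \<le> \<phi> x"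
      and le: "\<And>x. 0 \<le> x \<Longrightarrow> \<phi> x *\<^sub>R a \<le> x" and one: "\<phi> a = 1"
      using atom_coordinate[OF a(1)] by blast
    show ?thesis
    proof (rule rank_one_minorant[OF assms(1) \<phi>])
      show "\<phi> a \<noteq> 0"
        using one by simp
      show "0 < T a"
        using a T by (simp add: atom_def positive_operator_def less_le)
      show "\<phi> x *\<^sub>R T a \<le> T x" if "0 \<le> x" for x
        using positive_operator_mono[OF T le[OF that]] by (simp add: linear_scale[OF lin])
    qed
  next
    case False
    have "T x = 0" if "x \<in> span {a. atom a}" for x
      using linear_eq_0_on_span[OF lin _ that] False by blast
    then have zero: "T x = 0" if "x \<in> uniform_closure (span {a. atom a})" for x
      using positive_operator_zero_on_uniform_closure[OF T _ that] by blast
    have "uniform_closure (span {a::'e. atom a}) \<noteq> UNIV"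
      using zero T_ne by auto
    then have codim: "codimension_one (uniform_closure (span {a::'e. atom a}))"
      using assms(3) by blast
    obtain z where z: "T z \<noteq> 0"
      using T_ne by auto
    \<comment> \<open>A nonzero value at \<open>z\<close> forces one at the positive element \<open>\<bar>z\<bar>\<close>.\<close>
    have "T \<bar>z\<bar> \<noteq> 0"
      using positive_operator_abs_le[OF T, of z] z by auto
    then have w: "0 < T \<bar>z\<bar>"
      using T by (simp add: positive_operator_def less_le)
    have "\<exists>c. T x = c *\<^sub>R T \<bar>z\<bar>" for x
      by (rule codimension_one_rank_one[OF codim lin zero \<open>T \<bar>z\<bar> \<noteq> 0\<close>])
    then obtain \<phi> where \<phi>: "linear \<phi>" "\<And>x. 0 \<le> x \<Longrightarrow> 0 \<le> \<phi> x"
      and eq: "\<And>x. T x = \<phi> x *\<^sub>R T \<bar>z\<bar>"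
      using positive_rank_one_factorization[OF T w] by blast
    show ?thesis
    proof (rule rank_one_minorant[OF assms(1) \<phi> _ w])
      show "\<phi> z \<noteq> 0"
        using z eq[of z] by auto
      show "\<phi> x *\<^sub>R T \<bar>z\<bar> \<le> T x" for x
        by (simp add: eq[of x])
    qed
  qed
qed

end
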